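(* Let $H$ be a finite simple graph, let $m=\operatorname{girth}(H)$, and let $G=W(H)$ be the whisker graph of $H$. Then $\mathsf{MF}^q(G)$ is shellable for all integers $q$ with $$1\le q\le \begin{cases}\lceil m/2\rceil, & \text{if } m<\infty,\\ \nu(G), & \text{if } m=\infty.\end{cases}$$
   Context: For a finite simple graph $H$ with vertices $x_1,\dots,x_n$, the whisker graph $W(H)$ has vertex set $\{x_1,\dots,x_n,y_1,\dots,y_n\}$ (the $y_i$ being new vertices) and edge set $E(H)\cup\{\{x_i,y_i\}: 1\le i\le n\}$. The girth of $H$ is the length of its shortest cycle, with $\operatorname{girth}(H)=\infty$ if $H$ is acyclic. The matching number $\nu(G)$ is the maximum size of a set of pairwise disjoint edges of $G$. For an integer $q\ge1$, $\mathsf{MF}^q(G)$ is the simplicial complex on $V(G)$ whose faces are the subsets $F\subseteq V(G)$ such that the induced subgraph $G[F]$ contains no matching of size $q$. A (not necessarily pure) simplicial complex is shellable if its facets can be ordered $F_1,\dots,F_t$ such that for every $k=2,\dots,t$ the complex $\bigl(\bigcup_{i=1}^{k-1}\langle F_i\rangle\bigr)\cap\langle F_k\rangle$ is pure of dimension $\dim(F_k)-1$, where $\langle F\rangle$ denotes the simplex of all subsets of $F$. *)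

theory Defs
  imports Complex_Main "HOL-Library.Extended_Nat" "HOL-Library.Disjoint_Sets"
begin

section \<open>Finite simple graphs\<close>

locale fin_simple_graph =
  fixes V :: "'a set" and E :: "'a set set"
  assumes finite_verts: "finite V"
    and edge_subset: "e \<in> E \<Longrightarrow> e \<subseteq> V"
    and edge_card: "e \<in> E \<Longrightarrow> card e = 2"
begin

lemma finite_edges: "finite E"
  using finite_verts edge_subset by (meson Pow_iff finite_Pow_iff finite_subset subsetI)

end

definition induced_edges :: "'a set set \<Rightarrow> 'a set \<Rightarrow> 'a set set" where
  "induced_edges E F = {e \<in> E. e \<subseteq> F}"

definition graph_cycle :: "'a set set \<Rightarrow> 'a list \<Rightarrow> bool" where
  "graph_cycle E xs \<longleftrightarrow> length xs \<ge> 3 \<and> distinct xs \<and>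
     (\<forall>i < length xs. {xs ! i, xs ! (Suc i mod length xs)} \<in> E)"

text \<open>The infimum of the empty set in \<^typ>\<open>enat\<close> is \<open>\<infinity>\<close>, so acyclic graphs have
  infinite girth.\<close>

definition girth :: "'a set set \<Rightarrow> enat" where
  "girth E = (INF xs \<in> {xs. graph_cycle E xs}. enat (length xs))"

definition graph_matching :: "'a set set \<Rightarrow> 'a set set \<Rightarrow> bool" where
  "graph_matching E M \<longleftrightarrow> M \<subseteq> E \<and> disjoint M"

definition matching_number :: "'a set set \<Rightarrow> nat" where
  "matching_number E = Max (card ` {M. graph_matching E M})"

text \<open>In the whisker graph, \<^term>\<open>Inl x\<close> is the original vertex \<open>x\<close> and \<^term>\<open>Inr x\<close>
  is the new vertex attached to it.\<close>

definition whisker_verts :: "'a set \<Rightarrow> ('a + 'a) set" where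
  "whisker_verts V = Inl ` V \<union> Inr ` V"

definition whisker_edges :: "'a set \<Rightarrow> 'a set set \<Rightarrow> ('a + 'a) set set" where
  "whisker_edges V E = (\<lambda>e. Inl ` e) ` E \<union> (\<lambda>x. {Inl x, Inr x}) ` V"

lemma (in fin_simple_graph) fin_simple_graph_whisker:
  "fin_simple_graph (whisker_verts V) (whisker_edges V E)"
proof
  show "finite (whisker_verts V)"
    by (simp add: whisker_verts_def finite_verts)
next
  fix e assume "e \<in> whisker_edges V E"
  then show "e \<subseteq> whisker_verts V" "card e = 2"
    using edge_subset edge_card
    by (auto simp: whisker_edges_def whisker_verts_def card_image)
qed


section \<open>Simplicial complexes and shellability\<close>

text \<open>A complex is represented by its set of faces, the empty face included.\<close>

definition simplicial_complex_on :: "'a set \<Rightarrow> 'a set set \<Rightarrow> bool" where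
  "simplicial_complex_on V \<Delta> \<longleftrightarrow>
     {} \<in> \<Delta> \<and> (\<forall>F\<in>\<Delta>. F \<subseteq> V) \<and> (\<forall>F\<in>\<Delta>. \<forall>F'. F' \<subseteq> F \<longrightarrow> F' \<in> \<Delta>)"

definition facets :: "'a set set \<Rightarrow> 'a set set" where
  "facets \<Delta> = {F \<in> \<Delta>. \<forall>F'\<in>\<Delta>. F \<subseteq> F' \<longrightarrow> F' = F}"

text \<open>Integer-valued, since the empty face has dimension \<open>-1\<close>.\<close>

definition face_dim :: "'a set \<Rightarrow> int" where
  "face_dim F = int (card F) - 1"

definition pure_of_dim :: "'a set set \<Rightarrow> int \<Rightarrow> bool" where
  "pure_of_dim \<Delta> d \<longleftrightarrow> \<Delta> \<noteq> {} \<and> (\<forall>F \<in> facets \<Delta>. face_dim F = d)"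

text \<open>Nonpure shellability of a finite complex. Facets are listed from index \<open>0\<close>, and the
  simplex on \<open>F\<close> is \<^term>\<open>Pow F\<close>.\<close>

definition shellable :: "'a set set \<Rightarrow> bool" where
  "shellable \<Delta> \<longleftrightarrow> (\<exists>Fs. distinct Fs \<and> set Fs = facets \<Delta> \<and>
     (\<forall>k. 1 \<le> k \<and> k < length Fs \<longrightarrow>
        pure_of_dim ((\<Union>i<k. Pow (Fs ! i)) \<inter> Pow (Fs ! k)) (face_dim (Fs ! k) - 1)))"

definition MF :: "nat \<Rightarrow> 'a set \<Rightarrow> 'a set set \<Rightarrow> 'a set set" where
  "MF q V E = {F. F \<subseteq> V \<and> \<not> (\<exists>M. graph_matching (induced_edges E F) M \<and> card M = q)}"

lemma (in fin_simple_graph) simplicial_complex_on_MF: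
  assumes "1 \<le> q"
  shows "simplicial_complex_on V (MF q V E)"
proof -
  have "card M \<noteq> q" if "graph_matching (induced_edges E {}) M" for M
  proof -
    have "induced_edges E {} = {}"
      using edge_card by (fastforce simp: induced_edges_def)
    with that assms show ?thesis by (auto simp: graph_matching_def)
  qed
  moreover have "graph_matching (induced_edges E F) M"
    if "graph_matching (induced_edges E F') M" "F' \<subseteq> F" for F F' M
    using that by (auto simp: graph_matching_def induced_edges_def)
  ultimately show ?thesis
    unfolding simplicial_complex_on_def MF_def by blast
qed

end

theory Submission
  imports Defs "HOL-Library.Product_Lexorder"
begin

text \<open>
  Put \<open>r = q - 1\<close>. The girth enters only through one consequence: every cycle of \<open>H\<close> has more
  than \<open>2 * r\<close> vertices. If \<open>H\<close> has fewer than \<open>q\<close> vertices, they cover all edges of \<open>W(H)\<close>, so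
  the complex is a simplex. Otherwise the facets can be described explicitly. Let \<open>A\<close> be the set
  of original vertices in a face and \<open>B \<subseteq> A\<close> the set of those whose whisker lies entirely in the
  face. The largest face with these data is \<open>whisker_facet V A B\<close>, and the pairs that occur for
  facets are of two kinds.

  \<^item> \<open>cover_pairs\<close>: \<open>B\<close> is a vertex cover of \<open>H[A]\<close> with \<open>r\<close> elements. Then \<open>H[A]\<close> is a forest,
    because removing a vertex from a cycle leaves \<open>r\<close> disjoint edges, so that a cycle cannot be
    covered by \<open>r\<close> vertices.
  \<^item> \<open>cycle_pairs\<close>: \<open>B\<close> is empty, and \<open>H[A]\<close> contains a cycle but no \<open>q\<close> disjoint edges.

  That every face lies in one of these facets is a case distinction on \<open>H[A - B]\<close>: if it is a
  forest, then Koenig's equality of matching and covering number extends \<open>B\<close> to a cover of the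
  right size (\<open>acyclic_Koenig\<close>); if it has a cycle, then the cycle already contains \<open>r\<close> disjoint
  edges, and there is no room left for a whisker.

  In the shelling, the cover pairs precede the cycle pairs, and within each kind smaller sets \<open>A\<close>
  come first. Most exchanges then just delete a vertex from \<open>A\<close>. Two situations are left, both for
  cover pairs. If the two facets have the same \<open>A - B\<close>, an exchange of one element of \<open>B\<close> is
  wanted, and a lexicographic order on the sets \<open>A\<close> provides it. If they have the same \<open>A\<close>, two
  covers of the forest \<open>H[A]\<close> are compared. Here the vertices are numbered so that each of them
  has at most one neighbour with a smaller number, and covers are compared by their topmost
  difference \<open>z\<close>. Removing \<open>z\<close> from the later cover uncovers at most one edge, and its other end,
  which has a smaller number, repairs the cover.
\<close>

section \<open>A criterion for shellability\<close>

text \<open>Sorting the index set by \<open>key\<close> gives a shelling order, whichever way ties are broken: the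
  hypothesis is available as soon as \<open>key i \<le> key k\<close>, and the facet \<open>\<phi> j\<close> that it yields has a
  strictly smaller key, hence is listed before \<open>\<phi> k\<close> in any case.\<close>

lemma shellable_by_key:
  fixes \<phi> :: "'i \<Rightarrow> 'b set" and key :: "'i \<Rightarrow> 'k::linorder"
  assumes fin: "finite I" and inj: "inj_on \<phi> I" and fac: "facets \<Delta> = \<phi> ` I"
    and finF: "\<And>i. i \<in> I \<Longrightarrow> finite (\<phi> i)"
    and exch: "\<And>i k. i \<in> I \<Longrightarrow> k \<in> I \<Longrightarrow> i \<noteq> k \<Longrightarrow> key i \<le> key k \<Longrightarrow>
      \<exists>j\<in>I. key j < key k \<and> \<phi> i \<inter> \<phi> k \<subseteq> \<phi> j \<and> (\<exists>v. \<phi> k - \<phi> j = {v})"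
  shows "shellable \<Delta>"
proof -
  obtain xs where xs: "set xs = I" "distinct xs"
    using finite_distinct_list[OF fin] by blast
  define ys where "ys = sort_key key xs"
  have srt: "set ys = I" "distinct ys" "sorted (map key ys)"
    using xs by (simp_all add: ys_def)
  have pure: "pure_of_dim ((\<Union>i<k. Pow (\<phi> (ys ! i))) \<inter> Pow (\<phi> (ys ! k))) (face_dim (\<phi> (ys ! k)) - 1)"
    (is "pure_of_dim ?\<Gamma> _")
    if k: "1 \<le> k" "k < length ys" for k
  proof -
    have kI: "ys ! k \<in> I" using k srt by auto
    have "{} \<in> ?\<Gamma>" using k(1) by (auto intro!: exI[of _ 0])
    moreover have "face_dim G = face_dim (\<phi> (ys ! k)) - 1" if G: "G \<in> facets ?\<Gamma>" for G
    proof -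
      obtain i where i: "i < k" "G \<subseteq> \<phi> (ys ! i)" "G \<subseteq> \<phi> (ys ! k)"
        using G by (auto simp: facets_def)
      have "ys ! i \<in> I" using i k srt by auto
      moreover have "ys ! i \<noteq> ys ! k"
        using i k srt(2) by (simp add: nth_eq_iff_index_eq)
      moreover have "key (ys ! i) \<le> key (ys ! k)"
        using sorted_nth_mono[OF srt(3), of i k] i k by simp
      ultimately obtain j v where j: "j \<in> I" "key j < key (ys ! k)"
        "\<phi> (ys ! i) \<inter> \<phi> (ys ! k) \<subseteq> \<phi> j" "\<phi> (ys ! k) - \<phi> j = {v}"
        using exch kI by blast
      obtain l where l: "l < length ys" "ys ! l = j"
        using j(1) srt(1) by (metis in_set_conv_nth)
      \<comment> \<open>The inequality of keys is strict, so ties with \<open>k\<close> do not matter.\<close>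
      have "l < k"
      proof (rule ccontr)
        assume "\<not> l < k"
        then have "key (ys ! k) \<le> key (ys ! l)"
          using sorted_nth_mono[OF srt(3), of k l] l by simp
        with j(2) l(2) show False by simp
      qed
      then have "\<phi> j \<inter> \<phi> (ys ! k) \<in> ?\<Gamma>" using l by auto
      moreover have "G \<subseteq> \<phi> j \<inter> \<phi> (ys ! k)" using i j by blast
      ultimately have "G = \<phi> j \<inter> \<phi> (ys ! k)"
        using G unfolding facets_def by blast
      also have "\<dots> = \<phi> (ys ! k) - {v}" using j(4) by blast
      finally have "G = \<phi> (ys ! k) - {v}" .
      moreover have "v \<in> \<phi> (ys ! k)" using j(4) by blast
      ultimately have "Suc (card G) = card (\<phi> (ys ! k))"
        using card.remove[OF finF[OF kI]] by auto
      then show ?thesis by (simp add: face_dim_def flip: of_nat_Suc)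
    qed
    ultimately show ?thesis by (auto simp: pure_of_dim_def)
  qed
  show ?thesis
    unfolding shellable_def
  proof (intro exI[of _ "map \<phi> ys"] conjI allI impI)
    show "distinct (map \<phi> ys)" using srt inj by (simp add: distinct_map)
    show "set (map \<phi> ys) = facets \<Delta>" using srt fac by simp
  next
    fix k assume k: "1 \<le> k \<and> k < length (map \<phi> ys)"
    have "(\<Union>i<k. Pow (map \<phi> ys ! i)) = (\<Union>i<k. Pow (\<phi> (ys ! i)))"
      using k by (intro SUP_cong) auto
    then show "pure_of_dim ((\<Union>i<k. Pow (map \<phi> ys ! i)) \<inter> Pow (map \<phi> ys ! k))
        (face_dim (map \<phi> ys ! k) - 1)"
      using pure[of k] k by simp
  qed
qed

section \<open>Matchings, vertex covers and cycles\<close>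

definition has_matching :: "'a set set \<Rightarrow> 'a set \<Rightarrow> nat \<Rightarrow> bool" where
  "has_matching E A k \<longleftrightarrow> (\<exists>M. graph_matching (induced_edges E A) M \<and> card M = k)"

definition covers :: "'a set set \<Rightarrow> 'a set \<Rightarrow> 'a set \<Rightarrow> bool" where
  "covers E A B \<longleftrightarrow> (\<forall>e\<in>E. e \<subseteq> A \<longrightarrow> e \<inter> B \<noteq> {})"

definition has_cycle :: "'a set set \<Rightarrow> 'a set \<Rightarrow> bool" where
  "has_cycle E A \<longleftrightarrow> (\<exists>xs. graph_cycle E xs \<and> set xs \<subseteq> A)"

text \<open>Adding the vertices in the order of \<open>g\<close>, each new vertex is joined to at most one earlier
  one. Such a numbering exists exactly for forests.\<close>

definition elimination_order :: "'a set set \<Rightarrow> 'a set \<Rightarrow> ('a \<Rightarrow> nat) \<Rightarrow> bool" where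
  "elimination_order E A g \<longleftrightarrow> inj_on g A \<and>
    (\<forall>z\<in>A. \<forall>u\<in>A. \<forall>w\<in>A. {z, u} \<in> E \<longrightarrow> {z, w} \<in> E \<longrightarrow> g u < g z \<longrightarrow> g w < g z \<longrightarrow> u = w)"

lemma has_matchingI:
  "M \<subseteq> induced_edges E A \<Longrightarrow> disjoint M \<Longrightarrow> card M = k \<Longrightarrow> has_matching E A k"
  by (auto simp: has_matching_def graph_matching_def)

lemma has_matchingE:
  assumes "has_matching E A k"
  obtains M where "M \<subseteq> induced_edges E A" "disjoint M" "card M = k"
  using assms by (auto simp: has_matching_def graph_matching_def)

lemma has_matching_0: "has_matching E A 0"
  by (rule has_matchingI[of "{}"]) auto

lemma has_matching_mono:
  assumes "has_matching E A k" "A \<subseteq> A'"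
  shows "has_matching E A' k"
  using assms by (auto simp: has_matching_def graph_matching_def induced_edges_def)

lemma has_matching_le:
  assumes "has_matching E A k" "l \<le> k"
  shows "has_matching E A l"
proof -
  obtain M where M: "M \<subseteq> induced_edges E A" "disjoint M" "card M = k"
    using assms(1) by (rule has_matchingE)
  obtain N where N: "N \<subseteq> M" "card N = l"
    using assms(2) M(3) obtain_subset_with_card_n by metis
  show ?thesis
    using subset_trans[OF N(1) M(1)] pairwise_subset[OF M(2) N(1)] N(2) by (rule has_matchingI)
qed

lemma has_cycle_mono: "has_cycle E A \<Longrightarrow> A \<subseteq> A' \<Longrightarrow> has_cycle E A'"
  by (auto simp: has_cycle_def)

text \<open>The easy half of Koenig's theorem: distinct edges of a matching contain distinct elements of
  the cover.\<close>

lemma matching_le_cover: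
  assumes cov: "covers E A B" and fin: "finite B" and m: "has_matching E A k"
  shows "k \<le> card B"
proof -
  obtain M where M: "M \<subseteq> induced_edges E A" "disjoint M" "card M = k"
    using m by (rule has_matchingE)
  have "\<exists>b. b \<in> e \<inter> B" if "e \<in> M" for e
    using that M(1) cov unfolding covers_def induced_edges_def by blast
  then obtain b where b: "\<And>e. e \<in> M \<Longrightarrow> b e \<in> e \<inter> B" by metis
  have "inj_on b M"
  proof (rule inj_onI, rule ccontr)
    fix e e' assume "e \<in> M" "e' \<in> M" "b e = b e'" "e \<noteq> e'"
    then show False using b M(2) by (metis IntD1 disjointD disjoint_iff)
  qed
  moreover have "b ` M \<subseteq> B" using b by auto
  ultimately show ?thesis using M(3) fin card_inj_on_le by metis
qed

text \<open>A cycle as a periodic walk on the natural numbers that starts at a prescribed vertex, if that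
  vertex lies on the cycle. This absorbs the index arithmetic modulo the length once and for
  all.\<close>

lemma cycle_walk:
  assumes "graph_cycle E xs"
  obtains p :: "nat \<Rightarrow> 'a" where "inj_on p {..<length xs}" "\<And>t. {p t, p (Suc t)} \<in> E"
    "range p \<subseteq> set xs" "c \<in> set xs \<Longrightarrow> p 0 = c"
proof -
  let ?L = "length xs"
  have L: "?L \<ge> 3" and d: "distinct xs"
    and e: "\<And>i. i < ?L \<Longrightarrow> {xs ! i, xs ! (Suc i mod ?L)} \<in> E"
    using assms by (auto simp: graph_cycle_def)
  obtain j where j: "j < ?L" "c \<in> set xs \<Longrightarrow> xs ! j = c"
  proof (cases "c \<in> set xs")
    case False
    then show ?thesis using L by (intro that[of 0]) linarith+
  qed (auto simp: in_set_conv_nth)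
  define p where "p t = xs ! ((j + t) mod ?L)" for t
  show thesis
  proof (rule that[of p])
    show "inj_on p {..<?L}"
    proof (rule inj_onI)
      fix s t assume st: "s \<in> {..<?L}" "t \<in> {..<?L}" "p s = p t"
      have "0 < ?L" using L by linarith
      with d st(3) have "(j + s) mod ?L = (j + t) mod ?L"
        by (simp add: p_def nth_eq_iff_index_eq)
      then have "(int j + int s) mod int ?L = (int j + int t) mod int ?L"
        by (metis of_nat_add of_nat_mod)
      then have "int s mod int ?L = int t mod int ?L"
        by (metis add_diff_cancel_left' mod_diff_left_eq)
      then show "s = t" using st by simp
    qed
  next
    fix t
    have "(j + t) mod ?L < ?L" using L by (intro mod_less_divisor) linarith
    from e[OF this] show "{p t, p (Suc t)} \<in> E"
      by (simp add: p_def mod_Suc_eq)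
  next
    show "range p \<subseteq> set xs"
      using L by (auto simp: p_def intro!: nth_mem mod_less_divisor)
  next
    assume "c \<in> set xs" then show "p 0 = c" using j by (simp add: p_def)
  qed
qed

text \<open>Deleting a vertex turns the cycle into a path with at least \<open>2 * k\<close> vertices, whose edges can be
  taken alternately. Starting the walk at \<open>c\<close> means that \<open>p 1, \<dots>, p (2 * k)\<close> avoid \<open>c\<close>.\<close>

lemma cycle_minus_vertex_has_matching:
  assumes cyc: "graph_cycle E xs" and sub: "set xs \<subseteq> A" and k: "2 * k < length xs"
  shows "has_matching E (A - {c}) k"
proof -
  obtain p where p: "inj_on p {..<length xs}" "\<And>t. {p t, p (Suc t)} \<in> E"
    "range p \<subseteq> set xs" "c \<in> set xs \<Longrightarrow> p 0 = c"
    using cycle_walk[OF cyc, of c] by blast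
  define e where "e i = {p (2*i+1), p (2*i+2)}" for i
  have ne: "p s \<noteq> p t" if "s \<noteq> t" "s \<le> 2*k" "t \<le> 2*k" for s t
    using p(1) that k by (auto dest: inj_onD)
  have disj: "e i \<inter> e i' = {}" if "i < k" "i' < k" "i \<noteq> i'" for i i'
  proof -
    have "p s \<noteq> p t" if "s \<in> {2*i+1, 2*i+2}" "t \<in> {2*i'+1, 2*i'+2}" for s t
      using that \<open>i < k\<close> \<open>i' < k\<close> \<open>i \<noteq> i'\<close> by (intro ne) auto
    then show ?thesis by (auto simp: e_def)
  qed
  have "inj_on e {..<k}"
  proof (rule inj_onI, rule ccontr)
    fix i i' assume "i \<in> {..<k}" "i' \<in> {..<k}" "e i = e i'" "i \<noteq> i'"
    then have "e i \<inter> e i = {}" using disj[of i i'] by simp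
    then show False by (simp add: e_def)
  qed
  then have "card (e ` {..<k}) = k" by (simp add: card_image)
  moreover have "disjoint (e ` {..<k})"
    using disj by (intro disjointI) auto
  moreover have "e i \<in> induced_edges E (A - {c})" if "i < k" for i
  proof -
    have "p t \<noteq> c" if "1 \<le> t" "t \<le> 2*k" for t
    proof
      assume "p t = c"
      then have "p 0 = p t" using p(3,4) by auto
      then show False using ne[of 0 t] that by simp
    qed
    moreover have "p t \<in> A" for t using p(3) sub by auto
    ultimately show ?thesis
      using p(2)[of "2*i+1"] that by (auto simp: e_def induced_edges_def)
  qed
  ultimately show ?thesis by (intro has_matchingI[of "e ` {..<k}"]) auto
qed

text \<open>Suppose that there is a cycle in \<open>A\<close> and delete some \<open>c \<in> B\<close>. The other elements of \<open>B\<close> cover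
  what remains of \<open>A\<close>, but the remainder of the cycle still contains \<open>card B\<close> disjoint edges,
  one too many. If \<open>B\<close> is empty, then already an edge of the cycle is left uncovered.\<close>

lemma small_cover_no_cycle:
  assumes long: "\<And>xs. graph_cycle E xs \<Longrightarrow> 2 * card B < length xs"
    and cov: "covers E A B" and fin: "finite B"
  shows "\<not> has_cycle E A"
proof
  assume "has_cycle E A"
  then obtain xs where xs: "graph_cycle E xs" "set xs \<subseteq> A" by (auto simp: has_cycle_def)
  show False
  proof (cases "B = {}")
    case True
    have "0 < length xs" "{xs ! 0, xs ! (Suc 0 mod length xs)} \<in> E"
      using xs(1) unfolding graph_cycle_def
      by (metis gr0I not_numeral_le_zero)+
    moreover have "Suc 0 mod length xs < length xs"
      using \<open>0 < length xs\<close> by (rule mod_less_divisor)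
    ultimately show False
      using cov True xs(2) by (auto simp: covers_def dest!: bspec)
  next
    case False
    then obtain c where c: "c \<in> B" by blast
    have "covers E (A - {c}) (B - {c})"
      using cov by (fastforce simp: covers_def)
    then have "card B \<le> card (B - {c})"
      using matching_le_cover cycle_minus_vertex_has_matching[OF xs long[OF xs(1)]] fin
      by blast
    with c fin show False
      by (metis card_Diff1_less not_le)
  qed
qed

context fin_simple_graph
begin

lemma finite_induced_edges: "finite (induced_edges E A)"
  using finite_edges by (simp add: induced_edges_def)

lemma edge_ends:
  assumes "e \<in> E" "v \<in> e"
  obtains u where "e = {v, u}" "u \<noteq> v"
proof -
  obtain a b where "e = {a, b}" "a \<noteq> b"
    using edge_card[OF assms(1)] by (meson card_2_iff)
  with assms(2) that show thesis by (metis insertE insert_commute singletonD)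
qed

lemma edge_ne: "{u, v} \<in> E \<Longrightarrow> u \<noteq> v"
  using edge_card by fastforce

text \<open>The end \<open>v\<close> of a longest path in \<open>A\<close> works. All neighbours of \<open>v\<close> in \<open>A\<close> lie on the path,
  since otherwise it could be extended, and a neighbour other than the second vertex of the path
  would close a cycle.\<close>

lemma acyclic_leaf:
  assumes A: "A \<subseteq> V" "A \<noteq> {}" and acyc: "\<not> has_cycle E A"
  obtains v where "v \<in> A"
    and "\<And>u w. u \<in> A \<Longrightarrow> w \<in> A \<Longrightarrow> {v, u} \<in> E \<Longrightarrow> {v, w} \<in> E \<Longrightarrow> u = w"
proof -
  define P where "P xs \<longleftrightarrow> xs \<noteq> [] \<and> distinct xs \<and> set xs \<subseteq> A \<and>
    (\<forall>i. Suc i < length xs \<longrightarrow> {xs ! i, xs ! Suc i} \<in> E)" for xs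
  have finA: "finite A" using A(1) finite_verts finite_subset by blast
  have bound: "length xs < Suc (card A)" if "P xs" for xs
    using that finA by (metis P_def card_mono distinct_card le_imp_less_Suc)
  obtain a where "a \<in> A" using A(2) by blast
  then have "P [a]" by (simp add: P_def)
  then obtain xs where xs: "P xs" "\<And>ys. P ys \<Longrightarrow> length ys \<le> length xs"
    using ex_has_greatest_nat[of P "[a]" length "Suc (card A)"] bound by (meson less_imp_le)
  define v where "v = hd xs"
  have v0: "v = xs ! 0" using xs(1) by (simp add: P_def v_def hd_conv_nth)
  have second: "1 < length xs \<and> u = xs ! 1" if u: "u \<in> A" "{v, u} \<in> E" for u
  proof (cases "u \<in> set xs")
    case False
    have "{(u # xs) ! i, (u # xs) ! Suc i} \<in> E" if "Suc i < length (u # xs)" for i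
      using that u(2) xs(1) v0 by (cases i) (auto simp: P_def insert_commute)
    then have "P (u # xs)" using False u xs(1) by (auto simp: P_def)
    from xs(2)[OF this] show ?thesis by simp
  next
    case True
    then obtain j where j: "j < length xs" "xs ! j = u" by (metis in_set_conv_nth)
    have "j \<noteq> 0" using j(2) v0 edge_ne[OF u(2)] by metis
    moreover have "\<not> 2 \<le> j"
    proof
      assume j2: "2 \<le> j"
      let ?ys = "take (Suc j) xs"
      have len: "length ?ys = Suc j" using j by simp
      have "{?ys ! i, ?ys ! (Suc i mod length ?ys)} \<in> E" if "i < length ?ys" for i
      proof (cases "i = j")
        case True
        then show ?thesis using j u(2) v0 len by (simp add: insert_commute)
      next
        case False
        then show ?thesis using that len j xs(1) by (simp add: P_def)
      qed
      then have "graph_cycle E ?ys"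
        using j2 len xs(1) by (simp add: graph_cycle_def P_def)
      moreover have "set ?ys \<subseteq> A" using xs(1) set_take_subset by (fastforce simp: P_def)
      ultimately show False using acyc by (auto simp: has_cycle_def)
    qed
    ultimately have "j = 1" by linarith
    then show ?thesis using j by simp
  qed
  have "v \<in> A" using xs(1) by (auto simp: P_def v_def)
  then show thesis using second that by blast
qed

lemma acyclic_elimination_order:
  assumes "A \<subseteq> V" "\<not> has_cycle E A"
  shows "\<exists>g. elimination_order E A g"
proof -
  have "finite A" using assms(1) finite_verts finite_subset by blast
  then show ?thesis using assms
  proof (induction A rule: finite_psubset_induct)
    case (psubset A)
    show ?case
    proof (cases "A = {}")
      case True
      then show ?thesis by (simp add: elimination_order_def)
    next
      case False
      obtain v where v: "v \<in> A"
        "\<And>u w. u \<in> A \<Longrightarrow> w \<in> A \<Longrightarrow> {v, u} \<in> E \<Longrightarrow> {v, w} \<in> E \<Longrightarrow> u = w"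
        using acyclic_leaf[OF psubset.prems(1) False psubset.prems(2)] by blast
      \<comment> \<open>The leaf \<open>v\<close> receives the largest number, so that its only neighbour is below it.\<close>
      have "A - {v} \<subset> A" using v(1) by blast
      moreover have "\<not> has_cycle E (A - {v})"
        using psubset.prems(2) has_cycle_mono by blast
      moreover have "A - {v} \<subseteq> V" using psubset.prems(1) by blast
      ultimately have "\<exists>g. elimination_order E (A - {v}) g"
        by (intro psubset.IH)
      then obtain g :: "'a \<Rightarrow> nat" where g: "inj_on g (A - {v})"
        "\<forall>z\<in>A - {v}. \<forall>u\<in>A - {v}. \<forall>w\<in>A - {v}. {z, u} \<in> E \<longrightarrow> {z, w} \<in> E \<longrightarrow>
          g u < g z \<longrightarrow> g w < g z \<longrightarrow> u = w"
        unfolding elimination_order_def by (elim exE conjE)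
      obtain N where N: "\<And>a. a \<in> A \<Longrightarrow> g a < N"
        using finite_nat_set_iff_bounded[of "g ` A"] psubset.hyps by (auto intro: that)
      define h where "h = g(v := N)"
      have h: "h v = N" "\<And>a. a \<noteq> v \<Longrightarrow> h a = g a" by (auto simp: h_def)
      have "inj_on h A"
      proof (rule inj_onI)
        fix a b assume ab: "a \<in> A" "b \<in> A" "h a = h b"
        then show "a = b"
          using N[of a] N[of b] g(1) by (cases "a = v"; cases "b = v") (auto simp: h dest: inj_onD)
      qed
      moreover have "u = w" if *: "z \<in> A" "u \<in> A" "w \<in> A" "{z, u} \<in> E" "{z, w} \<in> E"
        "h u < h z" "h w < h z" for z u w
      proof (cases "z = v")
        case True then show ?thesis using v(2)[of u w] * by simp
      next
        case False
        then have "h z < N" using N *(1) by (simp add: h)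
        then have "u \<noteq> v" "w \<noteq> v" using * h(1) by auto
        then show ?thesis
          using g(2)[rule_format, of z u w] * False by (simp add: h)
      qed
      ultimately show ?thesis
        unfolding elimination_order_def by (intro exI[of _ h]) blast
    qed
  qed
qed

text \<open>Koenig's theorem for forests. A leaf \<open>v\<close> with neighbour \<open>p\<close> is removed together with \<open>p\<close>: the
  edge \<open>{v, p}\<close> enlarges the matching, and \<open>p\<close> alone covers all edges that were lost. An isolated
  \<open>v\<close> can simply be dropped.\<close>

lemma acyclic_Koenig:
  assumes "A \<subseteq> V" "\<not> has_cycle E A"
  shows "\<exists>B. B \<subseteq> A \<and> covers E A B \<and> has_matching E A (card B)"
proof -
  have "finite A" using assms(1) finite_verts finite_subset by blast
  then show ?thesis using assms
  proof (induction A rule: finite_psubset_induct)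
    case (psubset A)
    show ?case
    proof (cases "A = {}")
      case True
      have "e \<noteq> {}" if "e \<in> E" for e using edge_card[OF that] by auto
      then have "covers E {} {}" by (auto simp: covers_def)
      moreover have "has_matching E {} 0"
        by (rule has_matching_0)
      ultimately show ?thesis using True by auto
    next
      case False
      obtain v where v: "v \<in> A"
        "\<And>u w. u \<in> A \<Longrightarrow> w \<in> A \<Longrightarrow> {v, u} \<in> E \<Longrightarrow> {v, w} \<in> E \<Longrightarrow> u = w"
        using acyclic_leaf[OF psubset.prems(1) False psubset.prems(2)] by blast
      have IH: "\<exists>B. B \<subseteq> A' \<and> covers E A' B \<and> has_matching E A' (card B)" if "A' \<subset> A" for A'
      proof (rule psubset.IH[OF that])
        show "A' \<subseteq> V" using that psubset.prems(1) by blast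
        show "\<not> has_cycle E A'" using that psubset.prems(2) has_cycle_mono by blast
      qed
      show ?thesis
      proof (cases "\<exists>p\<in>A. {v, p} \<in> E")
        case True
        then obtain p where p: "p \<in> A" "{v, p} \<in> E" by blast
        obtain B where B: "B \<subseteq> A - {v, p}" "covers E (A - {v, p}) B"
          "has_matching E (A - {v, p}) (card B)"
          using IH[of "A - {v, p}"] v(1) by blast
        have "covers E A (insert p B)"
          unfolding covers_def
        proof (intro ballI impI notI)
          fix e assume e: "e \<in> E" "e \<subseteq> A" "e \<inter> insert p B = {}"
          have "v \<notin> e"
          proof
            assume "v \<in> e"
            then obtain u where "e = {v, u}" using edge_ends e(1) by metis
            then have "u = p" using v(2) p e by blast
            then show False using \<open>e = {v, u}\<close> e(3) by simp
          qed
          then have "e \<subseteq> A - {v, p}" using e by auto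
          then show False using B(2) e by (auto simp: covers_def)
        qed
        moreover have "has_matching E A (card (insert p B))"
        proof -
          obtain M where M: "M \<subseteq> induced_edges E (A - {v, p})" "disjoint M" "card M = card B"
            using B(3) by (rule has_matchingE)
          have away: "e \<inter> {v, p} = {}" if "e \<in> M" for e
            using that M(1) unfolding induced_edges_def by blast
          then have "{v, p} \<notin> M" by blast
          moreover have "finite M"
            using M(1) finite_induced_edges finite_subset by blast
          moreover have "finite B" "p \<notin> B"
            using B(1) psubset.hyps finite_subset by blast+
          ultimately have "card (insert {v, p} M) = card (insert p B)"
            using M(3) by simp
          moreover have "disjoint (insert {v, p} M)"
            using M(2) away by (auto simp: pairwise_insert disjnt_def)
          moreover have "insert {v, p} M \<subseteq> induced_edges E A"
            using M(1) p v(1) by (auto simp: induced_edges_def)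
          ultimately show ?thesis by (intro has_matchingI)
        qed
        ultimately show ?thesis using B(1) p(1) by (intro exI[of _ "insert p B"]) auto
      next
        case False
        obtain B where B: "B \<subseteq> A - {v}" "covers E (A - {v}) B" "has_matching E (A - {v}) (card B)"
          using IH[of "A - {v}"] v(1) by blast
        have "covers E A B"
          unfolding covers_def
        proof (intro ballI impI)
          fix e assume e: "e \<in> E" "e \<subseteq> A"
          have "v \<notin> e"
          proof
            assume "v \<in> e"
            then obtain u where "e = {v, u}" using edge_ends e(1) by metis
            then show False using False e by blast
          qed
          with e(2) have "e \<subseteq> A - {v}" by blast
          with B(2) e(1) show "e \<inter> B \<noteq> {}" by (simp add: covers_def)
        qed
        moreover have "has_matching E A (card B)"
          using B(3) Diff_subset by (rule has_matching_mono)
        moreover have "B \<subseteq> A" using B(1) by blast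
        ultimately show ?thesis by (intro exI[of _ B] conjI)
      qed
    qed
  qed
qed

end

section \<open>The facets of the complex of a whisker graph\<close>

text \<open>The set is given by its original vertices \<open>A\<close> and by those \<open>B\<close> among them whose whisker it
  contains. A new vertex \<open>Inr x\<close> with \<open>x \<notin> A\<close> is isolated in the induced subgraph, so a maximal
  face contains all of these.\<close>

definition whisker_facet :: "'a set \<Rightarrow> 'a set \<Rightarrow> 'a set \<Rightarrow> ('a + 'a) set" where
  "whisker_facet V A B = Inl ` A \<union> Inr ` (V - (A - B))"

definition cover_pairs :: "'a set \<Rightarrow> 'a set set \<Rightarrow> nat \<Rightarrow> ('a set \<times> 'a set) set" where
  "cover_pairs V E r = {(A, B). A \<subseteq> V \<and> B \<subseteq> A \<and> covers E A B \<and> card B = r}"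

definition cycle_pairs :: "'a set \<Rightarrow> 'a set set \<Rightarrow> nat \<Rightarrow> ('a set \<times> 'a set) set" where
  "cycle_pairs V E r = {(A, B). A \<subseteq> V \<and> B = {} \<and> has_cycle E A \<and> \<not> has_matching E A (Suc r)}"

lemma MF_iff: "F \<in> MF q V E \<longleftrightarrow> F \<subseteq> V \<and> \<not> has_matching E F q"
  by (simp add: MF_def has_matching_def)

lemma whisker_facet_iff [simp]:
  "Inl x \<in> whisker_facet V A B \<longleftrightarrow> x \<in> A"
  "Inr x \<in> whisker_facet V A B \<longleftrightarrow> x \<in> V \<and> \<not> (x \<in> A \<and> x \<notin> B)"
  by (auto simp: whisker_facet_def)

lemma whisker_set_subset_iff:
  "X \<subseteq> Y \<longleftrightarrow> (\<forall>x. Inl x \<in> X \<longrightarrow> Inl x \<in> Y) \<and> (\<forall>x. Inr x \<in> X \<longrightarrow> Inr x \<in> Y)"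
  by (metis obj_sumE subset_iff)

lemma whisker_set_eq_iff:
  "X = Y \<longleftrightarrow> (\<forall>x. Inl x \<in> X \<longleftrightarrow> Inl x \<in> Y) \<and> (\<forall>x. Inr x \<in> X \<longleftrightarrow> Inr x \<in> Y)"
  by (auto simp: set_eq_subset whisker_set_subset_iff)

lemma whisker_verts_iff [simp]:
  "Inl x \<in> whisker_verts V \<longleftrightarrow> x \<in> V" "Inr x \<in> whisker_verts V \<longleftrightarrow> x \<in> V"
  by (auto simp: whisker_verts_def)

text \<open>Covers of \<open>H\<close> serve as covers of induced subgraphs of the whisker graph, provided that they
  also meet every whisker that is present.\<close>

lemma covers_whisker:
  assumes "covers E A B" and "\<And>x. Inl x \<in> F \<Longrightarrow> x \<in> A"
    and "\<And>x. Inl x \<in> F \<Longrightarrow> Inr x \<in> F \<Longrightarrow> x \<in> B"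
  shows "covers (whisker_edges V E) F (Inl ` B)"
  unfolding covers_def
proof (intro ballI impI)
  fix e assume "e \<in> whisker_edges V E" and sub: "e \<subseteq> F"
  then consider d where "d \<in> E" "e = Inl ` d" | x where "e = {Inl x, Inr x}"
    unfolding whisker_edges_def by blast
  then show "e \<inter> Inl ` B \<noteq> {}"
  proof cases
    case 1
    then have "d \<subseteq> A" using sub assms(2) by blast
    then show ?thesis using 1 assms(1) unfolding covers_def by blast
  next
    case 2
    then show ?thesis using sub assms(3)[of x] by blast
  qed
qed

lemma has_matching_whiskerD:
  assumes m: "has_matching (whisker_edges V E) F k"
    and no: "\<And>x. Inl x \<in> F \<Longrightarrow> Inr x \<notin> F"
  shows "has_matching E (Inl -` F) k"
proof -
  obtain M where M: "M \<subseteq> induced_edges (whisker_edges V E) F" "disjoint M" "card M = k"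
    using m by (rule has_matchingE)
  have lift: "\<exists>d. d \<in> E \<and> d \<subseteq> Inl -` F \<and> e = Inl ` d" if "e \<in> M" for e
  proof -
    have eF: "e \<in> whisker_edges V E" "e \<subseteq> F"
      using that M(1) unfolding induced_edges_def by blast+
    then consider d where "d \<in> E" "e = Inl ` d" | x where "e = {Inl x, Inr x}"
      unfolding whisker_edges_def by blast
    then show ?thesis
    proof cases
      case 1
      then show ?thesis using eF(2) by blast
    next
      case 2
      then show ?thesis using eF(2) no[of x] by simp
    qed
  qed
  have base: "Inl -` e \<in> induced_edges E (Inl -` F)" "Inl ` (Inl -` e :: 'a set) = e"
    if "e \<in> M" for e
  proof -
    obtain d where d: "d \<in> E" "d \<subseteq> Inl -` F" "e = Inl ` d"
      using lift \<open>e \<in> M\<close> by blast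
    then have "Inl -` e = d" by auto
    with d show "Inl -` e \<in> induced_edges E (Inl -` F)" "Inl ` (Inl -` e :: 'a set) = e"
      by (simp_all add: induced_edges_def)
  qed
  have "inj_on (\<lambda>e. Inl -` e) M"
    using base(2) by (metis inj_onI)
  then have "card ((\<lambda>e. Inl -` e) ` M) = k" using M(3) by (simp add: card_image)
  moreover have "disjoint ((\<lambda>e. Inl -` e) ` M)"
    using M(2) by (auto simp: pairwise_def disjnt_def)
  moreover have "(\<lambda>e. Inl -` e) ` M \<subseteq> induced_edges E (Inl -` F)"
    using base(1) by blast
  ultimately show ?thesis by (intro has_matchingI)
qed

context fin_simple_graph
begin

text \<open>Whiskers at vertices outside \<open>C\<close> can be added to any matching of \<open>H[C]\<close>. This is the source of
  all large matchings below.\<close>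

lemma has_matching_whiskerI:
  assumes m: "has_matching E C k" and B: "B \<subseteq> V" "B \<inter> C = {}"
    and F: "Inl ` (B \<union> C) \<subseteq> F" "Inr ` B \<subseteq> F"
  shows "has_matching (whisker_edges V E) F (k + card B)"
proof -
  obtain M where M: "M \<subseteq> induced_edges E C" "disjoint M" "card M = k"
    using m by (rule has_matchingE)
  define N1 :: "('a + 'a) set set" where "N1 = (\<lambda>e. Inl ` e) ` M"
  define N2 :: "('a + 'a) set set" where "N2 = (\<lambda>x. {Inl x, Inr x}) ` B"
  have "finite M"
    using M(1) finite_induced_edges finite_subset by blast
  moreover have "finite B" using B(1) finite_verts finite_subset by blast
  ultimately have fin: "finite N1" "finite N2" by (simp_all add: N1_def N2_def)
  have cross: "d \<inter> e = {}" if "d \<in> N1" "e \<in> N2" for d e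
    using that M(1) B(2) by (auto simp: N1_def N2_def induced_edges_def)
  have "{} \<notin> N2" by (auto simp: N2_def)
  then have "N1 \<inter> N2 = {}" using cross by (metis disjoint_iff Int_absorb)
  then have "card (N1 \<union> N2) = card N1 + card N2" using fin by (simp add: card_Un_disjoint)
  moreover have "card N1 = k"
    unfolding N1_def M(3)[symmetric]
    by (intro card_image inj_onI) (simp add: inj_image_eq_iff)
  moreover have "card N2 = card B"
    unfolding N2_def by (intro card_image inj_onI) (auto simp: doubleton_eq_iff)
  moreover have "disjoint (N1 \<union> N2)"
  proof -
    have "disjoint N1" using M(2) by (auto simp: N1_def pairwise_def disjnt_def)
    moreover have "disjoint N2" by (auto simp: N2_def pairwise_def disjnt_def)
    ultimately show ?thesis using cross by (intro disjoint_union) auto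
  qed
  moreover have "N1 \<union> N2 \<subseteq> induced_edges (whisker_edges V E) F"
  proof -
    have "Inl ` d \<in> induced_edges (whisker_edges V E) F" if "d \<in> M" for d
      using that M(1) F(1) unfolding induced_edges_def whisker_edges_def by blast
    moreover have "{Inl x, Inr x} \<in> induced_edges (whisker_edges V E) F" if "x \<in> B" for x
      using that B(1) F unfolding induced_edges_def whisker_edges_def by blast
    ultimately show ?thesis by (auto simp: N1_def N2_def)
  qed
  ultimately show ?thesis by (intro has_matchingI) simp_all
qed

text \<open>The original vertices cover all edges, hence \<open>q\<close> disjoint edges do not exist at all and the
  full vertex set is the only facet.\<close>

lemma shellable_whisker_simplex:
  assumes "card V < q"
  shows "shellable (MF q (whisker_verts V) (whisker_edges V E))"
proof -
  let ?W = "whisker_verts V"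
  have "covers E V V"
    unfolding covers_def
  proof (intro ballI impI)
    fix e assume "e \<in> E" "e \<subseteq> V"
    then show "e \<inter> V \<noteq> {}" using edge_card[of e] by (auto simp: Int_absorb2)
  qed
  then have "covers (whisker_edges V E) ?W (Inl ` V)"
    by (rule covers_whisker) auto
  moreover have "card (Inl ` V :: ('a + 'a) set) = card V" by (simp add: card_image)
  ultimately have "\<not> has_matching (whisker_edges V E) ?W q"
    using matching_le_cover finite_verts assms by (metis finite_imageI not_le)
  then have "?W \<in> MF q ?W (whisker_edges V E)" by (simp add: MF_iff)
  then have "facets (MF q ?W (whisker_edges V E)) = {?W}"
    unfolding facets_def MF_def by blast
  then show ?thesis
    unfolding shellable_def by (intro exI[of _ "[?W]"]) simp
qed

end

text \<open>From here on the complex is the one for \<open>q = Suc r\<close>.\<close>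

locale long_cycle_graph = fin_simple_graph +
  fixes r :: nat
  assumes long_cycles: "graph_cycle E xs \<Longrightarrow> 2 * r < length xs"
    and card_verts: "r \<le> card V"
begin

abbreviation "WV \<equiv> whisker_verts V"
abbreviation "WE \<equiv> whisker_edges V E"
abbreviation "\<Delta> \<equiv> MF (Suc r) WV WE"
abbreviation "pairs \<equiv> cover_pairs V E r \<union> cycle_pairs V E r"

lemma finite_sub: "A \<subseteq> V \<Longrightarrow> finite A"
  using finite_verts finite_subset by blast

lemma cycle_minus_matching:
  assumes "has_cycle E A"
  shows "has_matching E (A - {c}) r"
proof -
  obtain xs where xs: "graph_cycle E xs" "set xs \<subseteq> A"
    using assms by (auto simp: has_cycle_def)
  show ?thesis by (rule cycle_minus_vertex_has_matching[OF xs long_cycles[OF xs(1)]])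
qed

lemma cover_pair_acyclic:
  assumes "(A, B) \<in> cover_pairs V E r"
  shows "\<not> has_cycle E A"
  using assms small_cover_no_cycle[of E B A] long_cycles finite_sub[of B]
  by (auto simp: cover_pairs_def)

lemma whisker_facet_is_face:
  assumes "(A, B) \<in> pairs"
  shows "whisker_facet V A B \<in> \<Delta>"
proof -
  let ?F = "whisker_facet V A B"
  have AV: "A \<subseteq> V" using assms by (auto simp: cover_pairs_def cycle_pairs_def)
  have "\<not> has_matching WE ?F (Suc r)"
  proof (cases "(A, B) \<in> cover_pairs V E r")
    case True
    then have B: "B \<subseteq> V" "covers E A B" "card B = r" by (auto simp: cover_pairs_def)
    have "covers WE ?F (Inl ` B)"
      using B(2) by (rule covers_whisker) auto
    moreover have "card (Inl ` B :: ('a + 'a) set) = r" using B(3) by (simp add: card_image)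
    ultimately show ?thesis
      using matching_le_cover[of WE ?F "Inl ` B" "Suc r"] finite_sub[OF B(1)] by auto
  next
    case False
    then have A: "B = {}" "\<not> has_matching E A (Suc r)"
      using assms by (auto simp: cycle_pairs_def)
    have "Inl -` ?F = A" by auto
    then show ?thesis using has_matching_whiskerD[of V E ?F "Suc r"] A by auto
  qed
  then show ?thesis using AV by (auto simp: MF_iff whisker_set_subset_iff)
qed

text \<open>A missing vertex is either an original vertex \<open>x \<notin> A\<close>, whose new partner is present, or the
  partner of some \<open>x \<in> A - B\<close>. In both cases it completes the whisker at \<open>x\<close>. This whisker joins
  those at \<open>B\<close>, or, for a cycle pair, the \<open>r\<close> disjoint edges that avoid \<open>x\<close>.\<close>

lemma whisker_facet_is_maximal:
  assumes p: "(A, B) \<in> pairs" and v: "v \<in> WV" "v \<notin> whisker_facet V A B"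
  shows "has_matching WE (insert v (whisker_facet V A B)) (Suc r)"
proof -
  have AB: "A \<subseteq> V" "B \<subseteq> A" using p by (auto simp: cover_pairs_def cycle_pairs_def)
  obtain x where x: "x \<in> V" "x \<notin> B" "v = Inl x \<and> x \<notin> A \<or> v = Inr x \<and> x \<in> A"
    using v AB(2) by (cases v) auto
  have card_ins: "card (insert x B) = Suc (card B)"
    using x(2) finite_sub[of B] AB by simp
  have xF: "Inl ` insert x B \<subseteq> insert v (whisker_facet V A B)"
    "Inr ` insert x B \<subseteq> insert v (whisker_facet V A B)"
    using AB x by auto
  show ?thesis
  proof (cases "(A, B) \<in> cover_pairs V E r")
    case True
    then have "card B = r" by (simp add: cover_pairs_def)
    moreover have "has_matching WE (insert v (whisker_facet V A B)) (0 + card (insert x B))"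
      using xF AB x(1) by (intro has_matching_whiskerI[OF has_matching_0[of _ "{}"]]) auto
    ultimately show ?thesis using card_ins by simp
  next
    case False
    then have B: "B = {}" "has_cycle E A" using p by (auto simp: cycle_pairs_def)
    have "has_matching WE (insert v (whisker_facet V A B)) (r + card {x})"
      using xF x(1) B(1)
      by (intro has_matching_whiskerI[OF cycle_minus_matching[OF B(2), of x]]) auto
    then show ?thesis by simp
  qed
qed

text \<open>A matching of \<open>H[A - B]\<close> extends by the whiskers at \<open>B\<close>, so it has at most \<open>r - card B\<close> edges.
  If \<open>H[A - B]\<close> is a forest, it therefore has a cover \<open>K\<close> of at most that size, and \<open>B \<union> K\<close> can be
  filled up to a cover with \<open>r\<close> elements. If it has a cycle, then \<open>r - card B\<close> is at least \<open>r\<close>, so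
  \<open>B\<close> is empty.\<close>

lemma face_in_whisker_facet:
  assumes F: "F \<in> \<Delta>"
  shows "\<exists>(A, B) \<in> pairs. F \<subseteq> whisker_facet V A B"
proof -
  define A where "A = (Inl -` F :: 'a set)"
  define B where "B = A \<inter> Inr -` F"
  have FW: "F \<subseteq> WV" and no: "\<not> has_matching WE F (Suc r)" using F by (auto simp: MF_iff)
  have AV: "A \<subseteq> V" using FW by (auto simp: A_def)
  have BA: "B \<subseteq> A" by (simp add: B_def)
  have size: "k + card B \<le> r" if "has_matching E (A - B) k" for k
  proof -
    have "has_matching WE F (k + card B)"
      using AV by (intro has_matching_whiskerI[OF that]) (auto simp: A_def B_def)
    then show ?thesis using no has_matching_le by (metis not_less_eq_eq)
  qed
  show ?thesis
  proof (cases "has_cycle E (A - B)")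
    case False
    then obtain K where K: "K \<subseteq> A - B" "covers E (A - B) K" "has_matching E (A - B) (card K)"
      using acyclic_Koenig[of "A - B"] AV by blast
    have "card (B \<union> K) \<le> r"
      using size[OF K(3)] card_Un_le[of B K] by linarith
    then obtain B' where B': "B \<union> K \<subseteq> B'" "B' \<subseteq> V" "card B' = r"
      using exists_subset_between[of "B \<union> K" r V] card_verts finite_verts K(1) AV BA by blast
    have "covers E (A \<union> B') B'"
      unfolding covers_def
    proof (intro ballI impI notI)
      fix e assume e: "e \<in> E" "e \<subseteq> A \<union> B'" "e \<inter> B' = {}"
      then have "e \<subseteq> A - B" using B'(1) by blast
      then show False using K(2) e B'(1) unfolding covers_def by blast
    qed
    then have "(A \<union> B', B') \<in> pairs" using B' AV by (auto simp: cover_pairs_def)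
    moreover have "F \<subseteq> whisker_facet V (A \<union> B') B'"
      using FW B'(1) by (auto simp: whisker_set_subset_iff A_def B_def)
    ultimately show ?thesis by blast
  next
    case True
    have "has_matching E (A - B) r"
      using has_matching_mono[OF cycle_minus_matching[OF True]] by blast
    then have "card B = 0" using size by fastforce
    then have B0: "B = {}" using finite_sub[of B] AV BA by auto
    then have "has_cycle E A" "\<not> has_matching E A (Suc r)"
      using True size[of "Suc r"] by auto
    then have "(A, {}) \<in> pairs" using AV by (simp add: cycle_pairs_def)
    moreover have "F \<subseteq> whisker_facet V A {}"
      using FW B0 by (auto simp: whisker_set_subset_iff A_def B_def)
    ultimately show ?thesis by blast
  qed
qed

lemma facets_whisker: "facets \<Delta> = (\<lambda>(A, B). whisker_facet V A B) ` pairs"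
proof -
  have sub: "G = whisker_facet V A B"
    if AB: "(A, B) \<in> pairs" and G: "G \<in> \<Delta>" "whisker_facet V A B \<subseteq> G" for A B G
  proof (rule ccontr)
    assume "G \<noteq> whisker_facet V A B"
    then obtain v where v: "v \<in> G" "v \<notin> whisker_facet V A B" using G(2) by blast
    have "v \<in> WV" using v(1) G(1) by (auto simp: MF_iff)
    from whisker_facet_is_maximal[OF AB this v(2)]
    have "has_matching WE G (Suc r)" by (rule has_matching_mono) (use v(1) G(2) in blast)
    then show False using G(1) by (simp add: MF_iff)
  qed
  show ?thesis
  proof (intro equalityI subsetI)
    fix F assume F: "F \<in> facets \<Delta>"
    then obtain A B where AB: "(A, B) \<in> pairs" "F \<subseteq> whisker_facet V A B"
      using face_in_whisker_facet[of F] by (auto simp: facets_def)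
    then have "F = whisker_facet V A B"
      using F whisker_facet_is_face unfolding facets_def by blast
    then show "F \<in> (\<lambda>(A, B). whisker_facet V A B) ` pairs" using AB(1) by blast
  next
    fix F assume "F \<in> (\<lambda>(A, B). whisker_facet V A B) ` pairs"
    then obtain A B where "(A, B) \<in> pairs" "F = whisker_facet V A B"
      by (elim imageE) (simp split: prod.splits)
    then show "F \<in> facets \<Delta>"
      using sub[of A B] whisker_facet_is_face[of A B] unfolding facets_def by blast
  qed
qed

lemma inj_on_whisker_facet: "inj_on (\<lambda>(A, B). whisker_facet V A B) pairs"
proof -
  have "A = A' \<and> B = B'"
    if "(A, B) \<in> pairs" "(A', B') \<in> pairs" "whisker_facet V A B = whisker_facet V A' B'" for A B A' B'
  proof -
    have *: "A \<subseteq> V" "B \<subseteq> A" "B' \<subseteq> A'"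
      using that(1,2) by (auto simp: cover_pairs_def cycle_pairs_def)
    have "A = A'" using that(3) by (auto simp: whisker_set_eq_iff)
    moreover have "x \<in> B \<longleftrightarrow> x \<in> B'" if "x \<in> A" for x
      using \<open>whisker_facet V A B = whisker_facet V A' B'\<close> that * \<open>A = A'\<close>
      by (auto simp: whisker_set_eq_iff)
    ultimately show ?thesis using * by blast
  qed
  then show ?thesis by (auto simp: inj_on_def)
qed

end

section \<open>The shelling\<close>

text \<open>Compared lexicographically. For each kind of pairs the second entry prefers small \<open>A\<close>. The third
  entry matters for pairs with the same \<open>A - B\<close>, where \<open>f\<close> can be any numbering of the vertices.
  The last entry matters for two covers of the same \<open>A\<close>, where \<open>g A\<close> is an elimination order of
  the forest \<open>H[A]\<close>. The exchange argument uses this entry only between pairs with equal \<open>A\<close>, which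
  is why unrelated orders \<open>g A\<close> can be chosen for different \<open>A\<close>.\<close>

definition shelling_key ::
  "nat \<Rightarrow> ('a \<Rightarrow> nat) \<Rightarrow> ('a set \<Rightarrow> 'a \<Rightarrow> nat) \<Rightarrow> 'a set \<times> 'a set \<Rightarrow> nat \<times> nat \<times> nat \<times> nat" where
  "shelling_key r f g = (\<lambda>(A, B). (if card B = r then 0 else 1, card A,
     \<Sum>a\<in>A. 2 ^ f a, \<Sum>b\<in>B. 2 ^ g A b))"

text \<open>Summing powers of two over an injective numbering turns comparison of finite sets by their
  topmost difference into comparison of numbers.\<close>

lemma sum_pow2_le_imp_top_difference:
  fixes h :: "'b \<Rightarrow> nat"
  assumes fin: "finite X" "finite Y" and inj: "inj_on h (X \<union> Y)"
    and le: "(\<Sum>x\<in>X. 2 ^ h x) \<le> (\<Sum>y\<in>Y. (2::nat) ^ h y)" and ne: "X \<noteq> Y"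
  obtains z where "z \<in> Y - X"
    and "\<And>u. u \<in> X - Y \<Longrightarrow> h u < h z" and "\<And>u. u \<in> Y - X \<Longrightarrow> h u \<le> h z"
proof -
  define S where "S = (X - Y) \<union> (Y - X)"
  have "finite S" "S \<noteq> {}" using fin ne by (auto simp: S_def)
  then obtain z where z: "z \<in> S" "\<And>u. u \<in> S \<Longrightarrow> h u \<le> h z"
    using finite_imageI[of S h] Max_in[of "h ` S"] Max_ge[of "h ` S"]
    by (smt (verit) image_iff image_is_empty)
  have less: "h u < h z" if "u \<in> S" "u \<noteq> z" for u
  proof -
    have "h u \<noteq> h z"
      using inj that z(1) by (auto simp: S_def dest: inj_onD)
    with z(2)[OF that(1)] show ?thesis by simp
  qed
  \<comment> \<open>If the topmost difference were in \<open>X\<close>, its power of two would outweigh all of \<open>Y - X\<close>.\<close>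
  have "z \<in> Y"
  proof (rule ccontr)
    assume "z \<notin> Y"
    then have zX: "z \<in> X - Y" using z(1) by (auto simp: S_def)
    have "(\<Sum>y\<in>Y - X. (2::nat) ^ h y) = (\<Sum>i\<in>h ` (Y - X). 2 ^ i)"
      by (subst sum.reindex) (auto intro: inj_on_subset[OF inj])
    also have "\<dots> \<le> (\<Sum>i=0..<h z. 2 ^ i)"
          proof (intro sum_mono2)
      show "h ` (Y - X) \<subseteq> {0..<h z}"
        using less zX by (fastforce simp: S_def)
    qed auto
    also have "\<dots> < 2 ^ h z"
      by (simp add: sum_power2)
    also have "\<dots> \<le> (\<Sum>x\<in>X - Y. 2 ^ h x)"
      using zX fin by (intro member_le_sum) auto
    finally have "(\<Sum>y\<in>Y - X. (2::nat) ^ h y) < (\<Sum>x\<in>X - Y. 2 ^ h x)" .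
    moreover have "(\<Sum>x\<in>X. (2::nat) ^ h x) = (\<Sum>x\<in>X \<inter> Y. 2 ^ h x) + (\<Sum>x\<in>X - Y. 2 ^ h x)"
      using fin by (metis sum.Int_Diff)
    moreover have "(\<Sum>x\<in>Y. (2::nat) ^ h x) = (\<Sum>x\<in>X \<inter> Y. 2 ^ h x) + (\<Sum>x\<in>Y - X. 2 ^ h x)"
      using fin by (metis sum.Int_Diff Int_commute)
    ultimately show False using le by simp
  qed
  with z(1) have "z \<in> Y - X" by (auto simp: S_def)
  then show thesis
    using less z by (intro that[of z]) (auto simp: S_def)
qed

lemma Int_subset_if_Diff_eq_singleton:
  assumes "F2 - F3 = {v}" "v \<notin> F1"
  shows "F1 \<inter> F2 \<subseteq> F3"
  using assms by (metis DiffI IntE singletonD subsetI)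

lemma sum_pow2_swap_less:
  fixes h :: "'a \<Rightarrow> nat"
  assumes "finite B" "z \<in> B" "x \<notin> B" "h x < h z"
  shows "(\<Sum>b\<in>insert x (B - {z}). 2 ^ h b) < (\<Sum>b\<in>B. (2::nat) ^ h b)"
  using assms by (simp add: sum.remove[of B z])

lemma card_swap:
  assumes "finite B" "z \<in> B" "x \<notin> B"
  shows "card (insert x (B - {z})) = card B"
  using assms card_Suc_Diff1[of B z] by (simp del: card_Diff_insert card_Diff_singleton)

context long_cycle_graph
begin

lemma cover_pair_drop_vertex:
  assumes "(A, B) \<in> cover_pairs V E r" "x \<in> A - B"
  shows "(A - {x}, B) \<in> cover_pairs V E r"
  using assms by (auto simp: cover_pairs_def covers_def)

text \<open>Unless \<open>A2 \<subseteq> A1\<close>, some vertex of \<open>A2\<close> is missing in \<open>A1\<close>, and it is the one to be removed. It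
  can be dropped at once if it is not in \<open>B2\<close>. If it is, its place in the cover has to be taken by
  another vertex, to keep \<open>r\<close> elements: by a vertex of \<open>A2 - B2\<close>, which makes \<open>A\<close> smaller, or, if
  \<open>A2 - B2\<close> is disjoint from \<open>B1\<close>, by one of \<open>A1 - A2\<close>, which keeps \<open>A - B\<close> and is governed by
  \<open>f\<close>. If \<open>A2 \<subseteq> A1\<close>, then \<open>A1 = A2\<close> by the second entry of the key, and the covers \<open>B1\<close> and \<open>B2\<close>
  of one forest are compared.\<close>

lemma cover_pair_exchange:
  assumes I1: "(A1, B1) \<in> cover_pairs V E r" and I2: "(A2, B2) \<in> cover_pairs V E r"
    and ne: "(A1, B1) \<noteq> (A2, B2)"
    and le: "shelling_key r f g (A1, B1) \<le> shelling_key r f g (A2, B2)"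
    and f: "inj_on f V"
    and g: "\<And>A. A \<subseteq> V \<Longrightarrow> \<not> has_cycle E A \<Longrightarrow> elimination_order E A (g A)"
  shows "\<exists>(A3, B3) \<in> pairs.
    shelling_key r f g (A3, B3) < shelling_key r f g (A2, B2) \<and>
    whisker_facet V A1 B1 \<inter> whisker_facet V A2 B2 \<subseteq> whisker_facet V A3 B3 \<and>
    (\<exists>v. whisker_facet V A2 B2 - whisker_facet V A3 B3 = {v})"
proof -
  have p1: "A1 \<subseteq> V" "B1 \<subseteq> A1" "covers E A1 B1" "card B1 = r"
    and p2: "A2 \<subseteq> V" "B2 \<subseteq> A2" "covers E A2 B2" "card B2 = r"
    using I1 I2 by (auto simp: cover_pairs_def)
  have fin: "finite A1" "finite A2" "finite B1" "finite B2"
    using finite_sub p1 p2 by blast+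
  have le_card: "card A1 \<le> card A2"
    using le p1(4) p2(4) by (auto simp: shelling_key_def)
  have goal: ?thesis
    if "(A3, B3) \<in> cover_pairs V E r"
      "shelling_key r f g (A3, B3) < shelling_key r f g (A2, B2)"
      and diff: "whisker_facet V A2 B2 - whisker_facet V A3 B3 = {v}"
      and v: "v \<notin> whisker_facet V A1 B1" for A3 B3 v
    using that(2) diff Int_subset_if_Diff_eq_singleton[OF diff v]
    by (intro bexI[OF _ UnI1[OF that(1)]]) auto
  consider x where "x \<in> A2 - B2" "x \<notin> A1"
    | "A2 \<subseteq> A1"
    | z where "A2 - B2 \<subseteq> A1" "z \<in> B2" "z \<notin> A1"
    using p2(2) by blast
  then show ?thesis
  proof cases
    case 1
    have "card (A2 - {x}) < card A2" using 1 fin by (intro psubset_card_mono) auto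
    then have "shelling_key r f g (A2 - {x}, B2) < shelling_key r f g (A2, B2)"
      using p2(4) by (simp add: shelling_key_def)
    moreover have "whisker_facet V A2 B2 - whisker_facet V (A2 - {x}) B2 = {Inl x}"
      using 1 p2(1) by (auto simp: whisker_set_eq_iff)
    moreover have "Inl x \<notin> whisker_facet V A1 B1" using 1 by simp
    ultimately show ?thesis by (rule goal[OF cover_pair_drop_vertex[OF I2 1(1)]])
  next
    case 2
    then have A: "A1 = A2" using fin le_card card_seteq by metis
    let ?A = A2
    have ord: "elimination_order E ?A (g ?A)"
      using g p2(1) cover_pair_acyclic[OF I2] by blast
    then have inj: "inj_on (g ?A) ?A" by (simp add: elimination_order_def)
    have "(\<Sum>b\<in>B1. 2 ^ g ?A b) \<le> (\<Sum>b\<in>B2. (2::nat) ^ g ?A b)"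
      using le A p1(4) p2(4) by (simp add: shelling_key_def)
    moreover have "B1 \<noteq> B2" using ne A by simp
    moreover have "inj_on (g ?A) (B1 \<union> B2)"
      using inj_on_subset[OF inj] p1(2) p2(2) A by blast
    ultimately obtain z where z: "z \<in> B2 - B1"
      and top: "\<And>u. u \<in> B1 - B2 \<Longrightarrow> g ?A u < g ?A z"
      using sum_pow2_le_imp_top_difference[of B1 B2 "g ?A"] fin by metis
    \<comment> \<open>The edges that only \<open>z\<close> covers in \<open>B2\<close> end in \<open>B1 - B2\<close>, that is, below \<open>z\<close>; so there is
      at most one such edge.\<close>
    have nbr: "u \<in> B1 - B2" if "{z, u} \<in> E" "u \<in> ?A - B2" for u
    proof -
      have "{z, u} \<subseteq> A1" using that z p2(2) A by auto
      then have "{z, u} \<inter> B1 \<noteq> {}" using p1(3) that(1) unfolding covers_def by blast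
      then show ?thesis using z that(2) by blast
    qed
    have uniq: "u = w" if "{z, u} \<in> E" "u \<in> ?A - B2" "{z, w} \<in> E" "w \<in> ?A - B2" for u w
    proof -
      have "g ?A u < g ?A z" "g ?A w < g ?A z" using nbr top that by blast+
      moreover have "z \<in> ?A" "u \<in> ?A" "w \<in> ?A" using z p2(2) that by auto
      ultimately show ?thesis using ord that unfolding elimination_order_def by blast
    qed
    have "\<not> B1 \<subseteq> B2"
      using card_subset_eq[of B2 B1] fin p1(4) p2(4) \<open>B1 \<noteq> B2\<close> by auto
    then obtain x where x: "x \<in> B1 - B2" "\<And>u. {z, u} \<in> E \<Longrightarrow> u \<in> ?A - B2 \<Longrightarrow> u = x"
      using nbr uniq by (cases "\<exists>u. {z, u} \<in> E \<and> u \<in> ?A - B2") blast+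
    define B3 where "B3 = insert x (B2 - {z})"
    have "covers E ?A B3"
      unfolding covers_def
    proof (intro ballI impI notI)
      fix e assume e: "e \<in> E" "e \<subseteq> ?A" "e \<inter> B3 = {}"
      have "e \<inter> B2 \<noteq> {}" using p2(3) e unfolding covers_def by blast
      then have "z \<in> e" using e(3) by (auto simp: B3_def)
      then obtain u where u: "e = {z, u}" "u \<noteq> z" using edge_ends e(1) by metis
      then have "u \<in> ?A - B2" using e by (auto simp: B3_def)
      then show False using x(2) u e by (auto simp: B3_def)
    qed
    moreover have "card B3 = r"
      using card_swap[of B2 z x] fin z x p2(4) by (simp add: B3_def)
    moreover have "B3 \<subseteq> ?A" using x p1(2) p2(2) A by (auto simp: B3_def)
    ultimately have I3: "(?A, B3) \<in> cover_pairs V E r" using p2(1) by (simp add: cover_pairs_def)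
    have "shelling_key r f g (?A, B3) < shelling_key r f g (A2, B2)"
      using sum_pow2_swap_less[of B2 z x "g ?A"] fin z x(1) top[OF x(1)] \<open>card B3 = r\<close> p2(4)
      by (simp add: shelling_key_def B3_def)
    moreover have "whisker_facet V A2 B2 - whisker_facet V ?A B3 = {Inr z}"
      using z x(1) p1 p2 A by (auto simp: whisker_set_eq_iff B3_def)
    moreover have "Inr z \<notin> whisker_facet V A1 B1" using z p2(2) A by auto
    ultimately show ?thesis by (rule goal[OF I3])
  next
    case 3
    show ?thesis
    proof (cases "\<exists>x. x \<in> A2 - B2 \<and> x \<in> B1")
      case True
      then obtain x where x: "x \<in> A2 - B2" "x \<in> B1" by blast
      define A3 B3 where "A3 = A2 - {z}" and "B3 = insert x (B2 - {z})"
      have zA: "z \<in> A2" using 3 p2(2) by blast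
      have "card B3 = r" using card_swap[of B2 z x] fin 3 x p2(4) by (simp add: B3_def)
      moreover have "covers E A3 B3"
        using p2(3) unfolding covers_def A3_def B3_def by blast
      moreover have "B3 \<subseteq> A3" using x 3 p2(2) by (auto simp: A3_def B3_def)
      ultimately have I3: "(A3, B3) \<in> cover_pairs V E r"
        using p2(1) by (auto simp: cover_pairs_def A3_def)
      have "card A3 < card A2" unfolding A3_def using zA fin by (intro psubset_card_mono) auto
      then have "shelling_key r f g (A3, B3) < shelling_key r f g (A2, B2)"
        using p2(4) \<open>card B3 = r\<close> by (simp add: shelling_key_def)
      moreover have "whisker_facet V A2 B2 - whisker_facet V A3 B3 = {Inl z}"
        using zA 3 x p2 by (auto simp: whisker_set_eq_iff A3_def B3_def)
      moreover have "Inl z \<notin> whisker_facet V A1 B1" using 3 by simp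
      ultimately show ?thesis by (rule goal[OF I3])
    next
      case False
      then have sub: "A2 - B2 \<subseteq> A1 - B1" using 3 by blast
      have "card (A1 - B1) \<le> card (A2 - B2)"
        using le_card p1 p2 fin by (simp add: card_Diff_subset)
      then have C: "A2 - B2 = A1 - B1" using sub fin by (meson card_seteq finite_Diff)
      then have cA: "card A1 = card A2"
        using p1 p2 fin by (metis card_Diff_subset card_mono le_add_diff_inverse)
      then have "(\<Sum>a\<in>A1. 2 ^ f a) \<le> (\<Sum>a\<in>A2. (2::nat) ^ f a)"
        using le p1(4) p2(4) by (auto simp: shelling_key_def)
      moreover have "A1 \<noteq> A2" using 3 p2(2) by blast
      moreover have "inj_on f (A1 \<union> A2)" using inj_on_subset[OF f] p1(1) p2(1) by blast
      ultimately obtain y where y: "y \<in> A2 - A1"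
        and top: "\<And>u. u \<in> A1 - A2 \<Longrightarrow> f u < f y"
        using sum_pow2_le_imp_top_difference[of A1 A2 f] fin by metis
      have "\<not> A1 \<subseteq> A2" using card_subset_eq[of A2 A1] fin cA \<open>A1 \<noteq> A2\<close> by auto
      then obtain x where x: "x \<in> A1 - A2" by blast
      have yB: "y \<in> B2" using y C by blast
      define A3 B3 where "A3 = insert x (A2 - {y})" and "B3 = insert x (B2 - {y})"
      have "x \<notin> A2" "x \<notin> B2" "y \<in> A2" using x y p2(2) by auto
      then have card3: "card B3 = r" "card A3 = card A2"
        unfolding A3_def B3_def using card_swap fin(2,4) yB p2(4) by metis+
      moreover have "covers E A3 B3"
        unfolding covers_def
      proof (intro ballI impI notI)
        fix e assume e: "e \<in> E" "e \<subseteq> A3" "e \<inter> B3 = {}"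
        then have "e \<subseteq> A2" "e \<inter> B2 = {}" by (auto simp: A3_def B3_def)
        then show False using p2(3) e(1) unfolding covers_def by blast
      qed
      moreover have "B3 \<subseteq> A3" using p2(2) by (auto simp: A3_def B3_def)
      moreover have "A3 \<subseteq> V" using x p1(1) p2(1) by (auto simp: A3_def)
      ultimately have I3: "(A3, B3) \<in> cover_pairs V E r" by (simp add: cover_pairs_def)
      have "shelling_key r f g (A3, B3) < shelling_key r f g (A2, B2)"
        using sum_pow2_swap_less[of A2 y x f] fin y x top[OF x] card3 p2(4)
        by (simp add: shelling_key_def A3_def)
      moreover have "whisker_facet V A2 B2 - whisker_facet V A3 B3 = {Inl y}"
        using x y yB p2 by (auto simp: whisker_set_eq_iff A3_def B3_def)
      moreover have "Inl y \<notin> whisker_facet V A1 B1" using y by simp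
      ultimately show ?thesis by (rule goal[OF I3])
    qed
  qed
qed

text \<open>A cycle pair is thus recognized by the first entry of the key. The two kinds could coincide in
  this respect only for \<open>r = 0\<close>, but then cycle pairs do not exist, as a cycle has an edge.\<close>

lemma cycle_pair_card:
  assumes "(A, B) \<in> cycle_pairs V E r"
  shows "card B \<noteq> r"
proof
  assume "card B = r"
  have p: "B = {}" "has_cycle E A" "\<not> has_matching E A (Suc r)"
    using assms by (auto simp: cycle_pairs_def)
  then have "r = 0" using \<open>card B = r\<close> by simp
  obtain xs where xs: "graph_cycle E xs" "set xs \<subseteq> A" using p(2) by (auto simp: has_cycle_def)
  then have "2 * 1 < length xs" by (simp add: graph_cycle_def)
  from cycle_minus_vertex_has_matching[OF xs this]
  have "has_matching E A 1" using has_matching_mono by blast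
  then show False using p(3) \<open>r = 0\<close> by simp
qed

text \<open>An earlier pair has some \<open>x \<in> A2\<close> outside \<open>A1\<close>: forests cannot contain the cycle in \<open>A2\<close>, and
  an earlier cycle pair has no larger \<open>A\<close>. If \<open>A2 - {x}\<close> still has a cycle, it gives an earlier
  cycle pair. Otherwise it is a forest whose matching number is exactly \<open>r\<close>, and a minimum cover
  makes it a cover pair.\<close>

lemma cycle_pair_exchange:
  assumes I1: "(A1, B1) \<in> pairs" and I2: "(A2, B2) \<in> cycle_pairs V E r"
    and ne: "(A1, B1) \<noteq> (A2, B2)"
    and le: "shelling_key r f g (A1, B1) \<le> shelling_key r f g (A2, B2)"
  shows "\<exists>(A3, B3) \<in> pairs.
    shelling_key r f g (A3, B3) < shelling_key r f g (A2, B2) \<and>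
    whisker_facet V A1 B1 \<inter> whisker_facet V A2 B2 \<subseteq> whisker_facet V A3 B3 \<and>
    (\<exists>v. whisker_facet V A2 B2 - whisker_facet V A3 B3 = {v})"
proof -
  have p2: "A2 \<subseteq> V" "B2 = {}" "has_cycle E A2" "\<not> has_matching E A2 (Suc r)"
    using I2 by (auto simp: cycle_pairs_def)
  have r: "card B2 \<noteq> r" by (rule cycle_pair_card[OF I2])
  have "\<not> A2 \<subseteq> A1"
  proof
    assume sub: "A2 \<subseteq> A1"
    then have "has_cycle E A1" using p2(3) has_cycle_mono by blast
    then have "(A1, B1) \<in> cycle_pairs V E r" using I1 cover_pair_acyclic by blast
    then have p1: "A1 \<subseteq> V" "B1 = {}" by (auto simp: cycle_pairs_def)
    then have "card A1 \<le> card A2" using le p2(2) r by (auto simp: shelling_key_def)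
    then have "A1 = A2" using sub finite_sub[OF p1(1)] card_seteq by metis
    then show False using ne p1 p2 by simp
  qed
  then obtain x where x: "x \<in> A2" "x \<notin> A1" by blast
  have less_card: "card (A2 - {x}) < card A2"
    using x finite_sub[OF p2(1)] by (intro psubset_card_mono) auto
  have no: "\<not> has_matching E (A2 - {x}) (Suc r)" using p2(4) has_matching_mono by blast
  obtain B3 where B3: "(A2 - {x}, B3) \<in> pairs"
    "shelling_key r f g (A2 - {x}, B3) < shelling_key r f g (A2, B2)"
  proof (cases "has_cycle E (A2 - {x})")
    case True
    then have "(A2 - {x}, {}) \<in> pairs" using no p2(1) by (auto simp: cycle_pairs_def)
    moreover have "shelling_key r f g (A2 - {x}, {}) < shelling_key r f g (A2, B2)"
      using less_card p2(2) r by (simp add: shelling_key_def)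
    ultimately show thesis by (rule that)
  next
    case False
    then obtain B where B: "B \<subseteq> A2 - {x}" "covers E (A2 - {x}) B"
      "has_matching E (A2 - {x}) (card B)"
      using acyclic_Koenig[of "A2 - {x}"] p2(1) by blast
    have "card B \<le> r" using has_matching_le[OF B(3), of "Suc r"] no by linarith
    moreover have "r \<le> card B"
      using matching_le_cover[OF B(2) _ cycle_minus_matching[OF p2(3)]] B(1) finite_sub p2(1)
      by blast
    ultimately have "card B = r" by simp
    then have "(A2 - {x}, B) \<in> pairs" using B p2(1) by (auto simp: cover_pairs_def)
    moreover have "shelling_key r f g (A2 - {x}, B) < shelling_key r f g (A2, B2)"
      using \<open>card B = r\<close> r by (simp add: shelling_key_def)
    ultimately show thesis by (rule that)
  qed
  have diff: "whisker_facet V A2 B2 - whisker_facet V (A2 - {x}) B3 = {Inl x}"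
    using x p2(1,2) by (auto simp: whisker_set_eq_iff)
  have "Inl x \<notin> whisker_facet V A1 B1" using x by simp
  from Int_subset_if_Diff_eq_singleton[OF diff this] show ?thesis
    using B3(2) diff by (intro bexI[OF _ B3(1)]) auto
qed

lemma shellable_whisker: "shellable \<Delta>"
proof -
  obtain f :: "'a \<Rightarrow> nat" where f: "inj_on f V"
    using finite_imp_inj_to_nat_seg[OF finite_verts] by blast
  have "\<forall>A. \<exists>g. A \<subseteq> V \<longrightarrow> \<not> has_cycle E A \<longrightarrow> elimination_order E A g"
    using acyclic_elimination_order by blast
  then obtain g where g: "\<And>A. A \<subseteq> V \<Longrightarrow> \<not> has_cycle E A \<Longrightarrow> elimination_order E A (g A)"
    by metis
  show ?thesis
  proof (rule shellable_by_key[where \<phi> = "\<lambda>(A, B). whisker_facet V A B" and I = pairs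
      and key = "shelling_key r f g"])
    have "pairs \<subseteq> Pow V \<times> Pow V" by (auto simp: cover_pairs_def cycle_pairs_def)
    then show "finite pairs" by (rule finite_subset) (simp add: finite_verts)
    show "inj_on (\<lambda>(A, B). whisker_facet V A B) pairs" by (rule inj_on_whisker_facet)
    show "facets \<Delta> = (\<lambda>(A, B). whisker_facet V A B) ` pairs" by (rule facets_whisker)
    show "finite (case p of (A, B) \<Rightarrow> whisker_facet V A B)" if "p \<in> pairs" for p
      using that finite_sub
      by (auto simp: whisker_facet_def cover_pairs_def cycle_pairs_def finite_verts)
  next
    fix p1 p2 assume p: "p1 \<in> pairs" "p2 \<in> pairs" "p1 \<noteq> p2"
      "shelling_key r f g p1 \<le> shelling_key r f g p2"
    obtain A1 B1 A2 B2 where [simp]: "p1 = (A1, B1)" "p2 = (A2, B2)"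
      by (cases p1, cases p2) blast
    have "\<exists>(A3, B3) \<in> pairs.
      shelling_key r f g (A3, B3) < shelling_key r f g (A2, B2) \<and>
      whisker_facet V A1 B1 \<inter> whisker_facet V A2 B2 \<subseteq> whisker_facet V A3 B3 \<and>
      (\<exists>v. whisker_facet V A2 B2 - whisker_facet V A3 B3 = {v})"
    proof (cases "(A2, B2) \<in> cycle_pairs V E r")
      case True
      then show ?thesis using cycle_pair_exchange[of A1 B1 A2 B2 f g] p by simp
    next
      case False
      then have I2: "(A2, B2) \<in> cover_pairs V E r" using p by simp
      then have "card B2 = r" by (simp add: cover_pairs_def)
      then have "card B1 = r" using p(4) by (auto simp: shelling_key_def split: if_splits)
      have "(A1, B1) \<in> cover_pairs V E r"
        using p(1) cycle_pair_card[of A1 B1] \<open>card B1 = r\<close> by auto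
      then show ?thesis using cover_pair_exchange[OF _ I2 _ _ f g, of A1 B1] p by simp
    qed
    then show "\<exists>p3\<in>pairs. shelling_key r f g p3 < shelling_key r f g p2 \<and>
        (case p1 of (A, B) \<Rightarrow> whisker_facet V A B) \<inter> (case p2 of (A, B) \<Rightarrow> whisker_facet V A B)
          \<subseteq> (case p3 of (A, B) \<Rightarrow> whisker_facet V A B) \<and>
        (\<exists>v. (case p2 of (A, B) \<Rightarrow> whisker_facet V A B) -
          (case p3 of (A, B) \<Rightarrow> whisker_facet V A B) = {v})"
      by auto
  qed
qed

end

theorem theorem1p2:
  fixes V :: "'a set" and E :: "'a set set" and q :: nat
  assumes "fin_simple_graph V E"
    and "1 \<le> q"
    and "q \<le> (case girth E of
                 enat m \<Rightarrow> nat \<lceil>real m / 2\<rceil>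
               | \<infinity> \<Rightarrow> matching_number (whisker_edges V E))"
  shows "shellable (MF q (whisker_verts V) (whisker_edges V E))"
proof -
  interpret fin_simple_graph V E by fact
  have long: "2 * (q - 1) < length xs" if "graph_cycle E xs" for xs
  proof -
    have le: "girth E \<le> enat (length xs)"
      unfolding girth_def using that by (intro INF_lower) simp
    then obtain m where m: "girth E = enat m" by (cases "girth E") auto
    have "q \<le> nat \<lceil>real m / 2\<rceil>" using assms(3) m by simp
    then have "2 * q \<le> m + 1" by linarith
    moreover have "m \<le> length xs" using le m by simp
    ultimately show ?thesis using assms(2) by linarith
  qed
  show ?thesis
  proof (cases "q \<le> card V")
    case True
    interpret long_cycle_graph V E "q - 1"
      using long True by unfold_locales auto
    show ?thesis using shellable_whisker assms(2) by simp
  next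
    case False
    then show ?thesis by (intro shellable_whisker_simplex) simp
  qed
qed

end
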